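(* Let $G=(V,A)$ be either a finite undirected graph or a finite acyclic directed graph, and let $B,D,E\subseteq V$ be sets of vertices. If there exists a (d-)separator between $B$ and $D$ given $E$, then the Markov blanket $\mathrm{mb}(B\to D|E)$ of $B$ in the direction of $D$ given $E$ exists, i.e. there is a minimal (d-)separator $M$ between $B$ and $D$ given $E$ such that $$D\perp M\,|\,M'\cup E\quad\text{for every (d-)separator } M' \text{ between } B \text{ and } D \text{ given } E;$$ it is unique, and it is given by $$\mathrm{mb}(B\to D|E)=\mathrm{mb}_{\mathrm{mb}_V(B|E)}(D|E)\quad\text{if } G \text{ is undirected},$$ $$\mathrm{mb}(B\to D|E)=\mathrm{mb}_{\mathrm{mb}_{\overline{\mathrm{asc}}(B\cup D\cup E)}(B|E)}(D|E)\quad\text{if } G \text{ is directed}.$$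
   Context: Relation $X\perp Y\,|\,Z$ for sets of vertices. Undirected case: a path is a sequence $v_0,\dots,v_k$ ($k\ge 0$) of vertices with consecutive vertices adjacent; it is active given $Z$ if none of its vertices is in $Z$. Directed acyclic case: a trail is a sequence $v_0,\dots,v_k$ ($k\ge0$) with $(v_{i-1},v_i)\in A$ or $(v_i,v_{i-1})\in A$ for each $i$; $v_i$ is a v-structure of the trail if $0<i<k$ and $(v_{i-1},v_i),(v_{i+1},v_i)\in A$; $\overline{\mathrm{dsc}}(v)$ is $v$ together with all its descendants; the trail is active given $Z$ if every vertex of it that is not a v-structure (endpoints included) is not in $Z$ and every v-structure $v$ of it satisfies $\overline{\mathrm{dsc}}(v)\cap Z\neq\emptyset$. In both cases, $X\perp Y\,|\,Z$ means that there is no path (resp. trail) active given $Z$ between a vertex of $X$ and a vertex of $Y$. For a set $S$ of vertices of a directed graph, $\overline{\mathrm{asc}}(S)$ is the set consisting of $S$ and of all vertices from which there is a directed path to a vertex of $S$. Markov blanket in a set. $\mathrm{mb}_C(B|E)$ is the smallest $M\subseteq C\setminus B$ with $B\perp C\setminus(B\cup M)\,|\,M\cup E$, in the sense that a set $M\subseteq C\setminus B$ satisfies this relation if and only if $\mathrm{mb}_C(B|E)\subseteq M$. It exists, is unique, and equals $\{v\in C\setminus B:\ \text{not } \{v\}\perp B\,|\,E\cup(C\setminus(B\cup\{v\}))\}$. (d-)separators. A (d-)separator between $B$ and $D$ given $E$ (separator if $G$ is undirected, d-separator if $G$ is directed) is a set $M\subseteq V\setminus(B\cup D)$ such that $B\perp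 D\,|\,M\cup E$. It is minimal if no strict subset $M'\subsetneq M$ satisfies $B\perp D\,|\,M'\cup E$. *)

theory Defs
  imports Main
begin

text \<open>
  A graph is given by a vertex set \<open>V\<close> and a relation \<open>A\<close> on it. An undirected graph is
  encoded by a symmetric relation; loops are allowed (they are irrelevant for separation).
\<close>

definition undirected_graph :: "'v set \<Rightarrow> 'v rel \<Rightarrow> bool" where
  "undirected_graph V A \<longleftrightarrow> finite V \<and> A \<subseteq> V \<times> V \<and> sym A"

definition acyclic_digraph :: "'v set \<Rightarrow> 'v rel \<Rightarrow> bool" where
  "acyclic_digraph V A \<longleftrightarrow> finite V \<and> A \<subseteq> V \<times> V \<and> acyclic A"

text \<open>
  Paths and trails are nonempty vertex lists, possibly of length one and with repetitions.
\<close>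

definition is_path :: "'v set \<Rightarrow> 'v rel \<Rightarrow> 'v list \<Rightarrow> bool" where
  "is_path V A p \<longleftrightarrow> p \<noteq> [] \<and> set p \<subseteq> V \<and> successively (\<lambda>u v. (u, v) \<in> A) p"

definition path_active :: "'v set \<Rightarrow> 'v list \<Rightarrow> bool" where
  "path_active Z p \<longleftrightarrow> set p \<inter> Z = {}"

definition sep :: "'v set \<Rightarrow> 'v rel \<Rightarrow> 'v set \<Rightarrow> 'v set \<Rightarrow> 'v set \<Rightarrow> bool" where
  "sep V A X Y Z \<longleftrightarrow>
     \<not> (\<exists>p. is_path V A p \<and> path_active Z p \<and> hd p \<in> X \<and> last p \<in> Y)"

definition is_trail :: "'v set \<Rightarrow> 'v rel \<Rightarrow> 'v list \<Rightarrow> bool" where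
  "is_trail V A p \<longleftrightarrow>
     p \<noteq> [] \<and> set p \<subseteq> V \<and> successively (\<lambda>u v. (u, v) \<in> A \<or> (v, u) \<in> A) p"

definition v_structure :: "'v rel \<Rightarrow> 'v list \<Rightarrow> nat \<Rightarrow> bool" where
  "v_structure A p i \<longleftrightarrow>
     0 < i \<and> Suc i < length p \<and> (p ! (i - 1), p ! i) \<in> A \<and> (p ! Suc i, p ! i) \<in> A"

definition dsc :: "'v rel \<Rightarrow> 'v \<Rightarrow> 'v set" where
  "dsc A v = {w. (v, w) \<in> A\<^sup>*}"

definition asc :: "'v rel \<Rightarrow> 'v set \<Rightarrow> 'v set" where
  "asc A S = {v. \<exists>s\<in>S. (v, s) \<in> A\<^sup>*}"

definition trail_active :: "'v rel \<Rightarrow> 'v set \<Rightarrow> 'v list \<Rightarrow> bool" where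
  "trail_active A Z p \<longleftrightarrow>
     (\<forall>i<length p. if v_structure A p i then dsc A (p ! i) \<inter> Z \<noteq> {} else p ! i \<notin> Z)"

definition dsep :: "'v set \<Rightarrow> 'v rel \<Rightarrow> 'v set \<Rightarrow> 'v set \<Rightarrow> 'v set \<Rightarrow> bool" where
  "dsep V A X Y Z \<longleftrightarrow>
     \<not> (\<exists>p. is_trail V A p \<and> trail_active A Z p \<and> hd p \<in> X \<and> last p \<in> Y)"

text \<open>
  The following notions are shared by both kinds of graphs. The parameter \<open>R\<close> is the ternary
  separation relation, \<open>sep V A\<close> or \<open>dsep V A\<close>, with \<open>R X Y Z\<close> read as
  \<open>X \<bottom> Y | Z\<close>.
\<close>

definition is_mb_in ::
  "('v set \<Rightarrow> 'v set \<Rightarrow> 'v set \<Rightarrow> bool) \<Rightarrow> 'v set \<Rightarrow> 'v set \<Rightarrow> 'v set \<Rightarrow> 'v set \<Rightarrow> bool" where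
  "is_mb_in R C B E N \<longleftrightarrow>
     N \<subseteq> C - B \<and> (\<forall>M. M \<subseteq> C - B \<longrightarrow> (R B (C - (B \<union> M)) (M \<union> E) \<longleftrightarrow> N \<subseteq> M))"

definition mb_in ::
  "('v set \<Rightarrow> 'v set \<Rightarrow> 'v set \<Rightarrow> bool) \<Rightarrow> 'v set \<Rightarrow> 'v set \<Rightarrow> 'v set \<Rightarrow> 'v set" where
  "mb_in R C B E = (THE N. is_mb_in R C B E N)"

definition separator ::
  "('v set \<Rightarrow> 'v set \<Rightarrow> 'v set \<Rightarrow> bool) \<Rightarrow> 'v set \<Rightarrow> 'v set \<Rightarrow> 'v set \<Rightarrow> 'v set \<Rightarrow> 'v set \<Rightarrow> bool" where
  "separator R V B D E M \<longleftrightarrow> M \<subseteq> V - (B \<union> D) \<and> R B D (M \<union> E)"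

definition minimal_separator ::
  "('v set \<Rightarrow> 'v set \<Rightarrow> 'v set \<Rightarrow> bool) \<Rightarrow> 'v set \<Rightarrow> 'v set \<Rightarrow> 'v set \<Rightarrow> 'v set \<Rightarrow> 'v set \<Rightarrow> bool" where
  "minimal_separator R V B D E M \<longleftrightarrow>
     separator R V B D E M \<and> \<not> (\<exists>M'. M' \<subset> M \<and> R B D (M' \<union> E))"

definition is_mb_dir ::
  "('v set \<Rightarrow> 'v set \<Rightarrow> 'v set \<Rightarrow> bool) \<Rightarrow> 'v set \<Rightarrow> 'v set \<Rightarrow> 'v set \<Rightarrow> 'v set \<Rightarrow> 'v set \<Rightarrow> bool" where
  "is_mb_dir R V B D E M \<longleftrightarrow>
     minimal_separator R V B D E M \<and> (\<forall>M'. separator R V B D E M' \<longrightarrow> R D M (M' \<union> E))"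

definition mb_dir ::
  "('v set \<Rightarrow> 'v set \<Rightarrow> 'v set \<Rightarrow> bool) \<Rightarrow> 'v set \<Rightarrow> 'v set \<Rightarrow> 'v set \<Rightarrow> 'v set \<Rightarrow> 'v set" where
  "mb_dir R V B D E = (THE M. is_mb_dir R V B D E M)"

end

theory Submission
  imports Defs
begin

text \<open>
  Both kinds of separation reduce to deleting vertices from an undirected graph. By the moral
  graph criterion (\<open>dsep_iff_reach_moral\<close>), \<open>X \<bottom> Y | Z\<close> holds in an acyclic directed graph iff
  no walk avoiding \<open>Z\<close> leads from \<open>X\<close> to \<open>Y\<close> in the moral graph of the ancestral closure of
  \<open>X \<union> Y \<union> Z\<close>. The difference to the undirected case is that this graph depends on the three sets.

  Let \<open>C\<close> be the closure of \<open>B \<union> D \<union> E\<close> (all vertices in the undirected case) and \<open>H\<close> its graph.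
  A separation statement between subsets of \<open>C\<close> that together contain \<open>B \<union> D \<union> E\<close> is one about \<open>H\<close>.
  The Markov blanket \<open>mb\<^bsub>C\<^esub>(B|E)\<close> is then the set \<open>N\<close> of neighbours in \<open>H\<close> of
  \<open>B - E\<close> outside \<open>B \<union> E\<close>, and \<open>mb\<^bsub>N\<^esub>(D|E)\<close> is the set \<open>M\<close> of the vertices of \<open>N\<close> that walks from
  \<open>D\<close> avoiding \<open>E\<close> can hit first. This \<open>M\<close> is the separator closest to \<open>B\<close>. Every walk
  from \<open>D\<close> to \<open>B\<close> avoiding \<open>E\<close> hits \<open>N\<close> first in \<open>M\<close>; every vertex of \<open>M\<close> lies on a walk from \<open>D\<close> to \<open>B\<close> that
  avoids \<open>E\<close> and meets \<open>N\<close> nowhere else, so \<open>M\<close> is minimal; and a walk from \<open>D\<close> to \<open>M\<close> that avoids \<open>E\<close> and another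
  separator could be prolonged by one edge to \<open>B\<close> (\<open>is_mb_dir_dir_blanket\<close>).

  For uniqueness, let \<open>K\<close> and \<open>L\<close> both have the property. A walk from \<open>D\<close> that avoids \<open>E\<close> cannot
  enter \<open>K \<union> L\<close> for the first time outside \<open>K \<inter> L\<close>, because \<open>D \<bottom> K | L \<union> E\<close> and
  \<open>D \<bottom> L | K \<union> E\<close>. Hence \<open>K \<inter> L\<close> already separates, and minimality gives
  \<open>K = K \<inter> L = L\<close> (\<open>is_mb_dir_unique\<close>).

  In the directed case some of these statements, such as \<open>D \<bottom> N - M | M \<union> E\<close>, do not mention \<open>B\<close>
  and therefore speak of a smaller moral graph than \<open>H\<close>. The smaller graph gives the same answer
  (\<open>moral_edge_local\<close>): a vertex that is reached from \<open>D\<close> and is missing from it is an ancestor of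
  \<open>B\<close> alone, so that directed edges would continue the walk to \<open>B\<close>, against separation.
\<close>

section \<open>Reachability in an undirected graph with deleted vertices\<close>

text \<open>
  Separation becomes disjointness from \<open>reach H Z X\<close>. The walks here avoid \<open>Z\<close> including their
  endpoints, which is why the starting points in \<open>Z\<close> are removed.
\<close>
definition reach :: "'v rel \<Rightarrow> 'v set \<Rightarrow> 'v set \<Rightarrow> 'v set" where
  "reach H Z X = (Restr H (- Z))\<^sup>* `` (X - Z)"

lemma reach_start: "x \<in> X \<Longrightarrow> x \<notin> Z \<Longrightarrow> x \<in> reach H Z X"
  unfolding reach_def by auto

lemma reach_step:
  assumes "u \<in> reach H Z X" "(u, v) \<in> H" "v \<notin> Z"
  shows "v \<in> reach H Z X"
proof -
  obtain x where x: "x \<in> X - Z" "(x, u) \<in> (Restr H (- Z))\<^sup>*"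
    using assms(1) unfolding reach_def by auto
  have "u \<notin> Z" using x(2,1) by (induction rule: rtrancl_induct) auto
  then have "(u, v) \<in> Restr H (- Z)" using assms by auto
  with x show ?thesis unfolding reach_def by (auto intro: rtrancl_into_rtrancl)
qed

lemma reach_induct [consumes 1, case_names start step]:
  assumes "y \<in> reach H Z X"
    and "\<And>x. x \<in> X \<Longrightarrow> x \<notin> Z \<Longrightarrow> P x"
    and "\<And>u v. u \<in> reach H Z X \<Longrightarrow> (u, v) \<in> H \<Longrightarrow> u \<notin> Z \<Longrightarrow> v \<notin> Z \<Longrightarrow> P u \<Longrightarrow> P v"
  shows "P y"
proof -
  obtain x where x: "x \<in> X - Z" "(x, y) \<in> (Restr H (- Z))\<^sup>*"
    using assms(1) unfolding reach_def by auto
  from x(2) show ?thesis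
  proof (induction rule: rtrancl_induct)
    case base
    then show ?case using x(1) assms(2) by auto
  next
    case (step u v)
    moreover have "u \<in> reach H Z X" using step(1) x(1) unfolding reach_def by auto
    ultimately show ?case using assms(3) by auto
  qed
qed

lemma reach_avoids: "y \<in> reach H Z X \<Longrightarrow> y \<notin> Z"
  by (induction rule: reach_induct)

lemma reach_mono:
  assumes "H \<subseteq> H'" "Z' \<subseteq> Z"
  shows "reach H Z X \<subseteq> reach H' Z' X"
proof
  fix y assume "y \<in> reach H Z X"
  then show "y \<in> reach H' Z' X"
    by (induction rule: reach_induct) (use assms in \<open>auto intro: reach_start reach_step\<close>)
qed

lemma reach_sym:
  assumes "sym H"
  shows "Y \<inter> reach H Z X = {} \<longleftrightarrow> X \<inter> reach H Z Y = {}"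
proof -
  have half: "X \<inter> reach H Z Y \<noteq> {}" if "Y \<inter> reach H Z X \<noteq> {}" for X Y
  proof -
    obtain x y where x: "x \<in> X - Z" "y \<in> Y" "(x, y) \<in> (Restr H (- Z))\<^sup>*" and "y \<in> reach H Z X"
      using \<open>Y \<inter> reach H Z X \<noteq> {}\<close> unfolding reach_def by auto
    then have "y \<notin> Z" by (simp add: reach_avoids)
    have "sym (Restr H (- Z))" using assms by (auto simp: sym_def)
    then have "(y, x) \<in> (Restr H (- Z))\<^sup>*" using x(3) by (meson sym_rtrancl symD)
    then show ?thesis using x \<open>y \<notin> Z\<close> unfolding reach_def by auto
  qed
  then show ?thesis by blast
qed

text \<open>
  The second alternative comes from stopping the walk at its first vertex in \<open>N\<close>.
\<close>
lemma reach_first_hit: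
  assumes "v \<in> reach H Z X"
  shows "v \<in> reach H (N \<union> Z) X \<or> (\<exists>n\<in>N. n \<in> reach H ((N - {n}) \<union> Z) X)"
  using assms
proof (induction rule: reach_induct)
  case (start x)
  then show ?case by (auto intro: reach_start)
next
  case (step u v)
  show ?case
  proof (cases "v \<in> N \<and> u \<in> reach H (N \<union> Z) X")
    case True
    have "reach H (N \<union> Z) X \<subseteq> reach H ((N - {v}) \<union> Z) X" by (rule reach_mono) auto
    with True step have "v \<in> reach H ((N - {v}) \<union> Z) X" by (auto intro: reach_step)
    then show ?thesis using True by blast
  next
    case False
    then show ?thesis using step by (auto intro: reach_step)
  qed
qed

text \<open>
  Seen from \<open>X\<close>, a vertex \<open>n\<close> that alone has been released from the deleted set \<open>F\<close> is entered for
  the first time from a vertex reached without it. The induction must allow for walks that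
  visit \<open>n\<close> several times.
\<close>
lemma reach_last_step:
  assumes "n \<in> reach H (F - {n}) X" "n \<notin> X"
  shows "\<exists>u\<in>reach H F X. (u, n) \<in> H"
proof -
  have "(w \<noteq> n \<and> w \<in> reach H F X) \<or> (\<exists>u\<in>reach H F X. (u, n) \<in> H)"
    if "w \<in> reach H (F - {n}) X" for w
    using that
  proof (induction rule: reach_induct)
    case (start x)
    then show ?case using assms(2) by (auto intro: reach_start)
  next
    case (step u v)
    then show ?case by (cases "v = n") (auto intro: reach_step)
  qed
  from this[OF assms(1)] show ?thesis by simp
qed

section \<open>Separation in graphs that depend on the vertices involved\<close>

text \<open>
  The properties shared by the two kinds of separation. A separation statement is decided in the
  graph \<open>graph S\<close> that belongs to the set \<open>S\<close> of all vertices it mentions, and this graph lives on a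
  closure \<open>cl S\<close>. The last assumption says when the set \<open>B\<close> may be dropped from \<open>S\<close>: if deleting
  \<open>F\<close> cuts \<open>D\<close> off from \<open>B\<close>, then the part of the graph explored from \<open>D\<close> up to \<open>F\<close>
  does not depend on \<open>B\<close>.
\<close>
locale local_separation =
  fixes V :: "'v set" and cl :: "'v set \<Rightarrow> 'v set" and graph :: "'v set \<Rightarrow> 'v rel"
    and R :: "'v set \<Rightarrow> 'v set \<Rightarrow> 'v set \<Rightarrow> bool"
  assumes cl_extensive: "S \<subseteq> V \<Longrightarrow> S \<subseteq> cl S"
    and cl_sub: "S \<subseteq> V \<Longrightarrow> cl S \<subseteq> V"
    and cl_least: "S \<subseteq> cl T \<Longrightarrow> cl S \<subseteq> cl T"
    and graph_mono: "S \<subseteq> cl T \<Longrightarrow> graph S \<subseteq> graph T"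
    and graph_sub: "graph S \<subseteq> cl S \<times> cl S"
    and graph_sym: "sym (graph S)"
    and R_iff: "\<lbrakk>X \<subseteq> V; Y \<subseteq> V; Z \<subseteq> V\<rbrakk> \<Longrightarrow> R X Y Z \<longleftrightarrow> Y \<inter> reach (graph (X \<union> Y \<union> Z)) Z X = {}"
    and local_edge: "\<lbrakk>B \<inter> reach (graph (B \<union> D \<union> F)) F D = {}; B \<union> D \<union> F \<subseteq> V;
          u \<in> reach (graph (B \<union> D \<union> F)) F D; v \<in> F \<union> reach (graph (B \<union> D \<union> F)) F D;
          (u, v) \<in> graph (B \<union> D \<union> F)\<rbrakk> \<Longrightarrow> (u, v) \<in> graph (D \<union> F)"
begin

text \<open>
  For every \<open>M \<subseteq> C - B\<close> the relation defining the Markov blanket mentions the same vertices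
  \<open>B \<union> C \<union> E\<close>, so a single graph decides it. There, \<open>M\<close> fails to separate iff some walk from \<open>B\<close>
  leaves \<open>B \<union> M\<close> within \<open>C\<close>, and the first vertex it hits there is in the set below.
\<close>
lemma is_mb_in_reach:
  assumes "C \<subseteq> V" "B \<subseteq> V" "E \<subseteq> V"
  shows "is_mb_in R C B E {v \<in> C - B. v \<in> reach (graph (B \<union> C \<union> E)) (E \<union> (C - (B \<union> {v}))) B}"
    (is "is_mb_in R C B E ?N")
  unfolding is_mb_in_def
proof (intro conjI allI impI)
  show "?N \<subseteq> C - B" by auto
  fix M assume M: "M \<subseteq> C - B"
  let ?H = "graph (B \<union> C \<union> E)" and ?Y = "C - (B \<union> M)"
  have "B \<union> ?Y \<union> (M \<union> E) = B \<union> C \<union> E" using M by auto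
  then have R: "R B ?Y (M \<union> E) \<longleftrightarrow> ?Y \<inter> reach ?H (M \<union> E) B = {}"
    using R_iff[of B ?Y "M \<union> E"] M assms by auto
  show "R B ?Y (M \<union> E) \<longleftrightarrow> ?N \<subseteq> M"
  proof
    assume r: "R B ?Y (M \<union> E)"
    show "?N \<subseteq> M"
    proof (rule ccontr)
      assume "\<not> ?N \<subseteq> M"
      then obtain n where n: "n \<in> C - B" "n \<notin> M" "n \<in> reach ?H (E \<union> (C - (B \<union> {n}))) B" by auto
      have "reach ?H (E \<union> (C - (B \<union> {n}))) B \<subseteq> reach ?H (M \<union> E) B"
        by (rule reach_mono) (use M n in auto)
      then show False using r R n by auto
    qed
  next
    assume N: "?N \<subseteq> M"
    have False if y: "y \<in> ?Y" "y \<in> reach ?H (M \<union> E) B" for y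
    proof -
      have "y \<notin> reach ?H (?Y \<union> (M \<union> E)) B" using y(1) reach_avoids by fastforce
      then obtain n where n: "n \<in> ?Y" "n \<in> reach ?H ((?Y - {n}) \<union> (M \<union> E)) B"
        using reach_first_hit[OF y(2), of ?Y] by auto
      have "(?Y - {n}) \<union> (M \<union> E) = E \<union> (C - (B \<union> {n}))" using M n(1) by auto
      then show False using n N by auto
    qed
    then show "R B ?Y (M \<union> E)" using R by auto
  qed
qed

lemma mb_in_reach:
  assumes "C \<subseteq> V" "B \<subseteq> V" "E \<subseteq> V"
  shows "mb_in R C B E = {v \<in> C - B. v \<in> reach (graph (B \<union> C \<union> E)) (E \<union> (C - (B \<union> {v}))) B}"
    (is "_ = ?N")
  unfolding mb_in_def
proof (rule the_equality)
  show N: "is_mb_in R C B E ?N" by (rule is_mb_in_reach[OF assms])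
  fix N' assume N': "is_mb_in R C B E N'"
  have "N' \<subseteq> ?N" using N N' unfolding is_mb_in_def by (metis (lifting) subset_refl)
  moreover have "?N \<subseteq> N'" using N N' unfolding is_mb_in_def by (metis (lifting) subset_refl)
  ultimately show "N' = ?N" by auto
qed

lemma separator_iff:
  assumes "B \<subseteq> V" "D \<subseteq> V" "E \<subseteq> V" "M \<subseteq> V"
  shows "R B D (M \<union> E) \<longleftrightarrow> B \<inter> reach (graph (B \<union> D \<union> E \<union> M)) (M \<union> E) D = {}"
proof -
  have "B \<union> D \<union> (M \<union> E) = B \<union> D \<union> E \<union> M" by auto
  then show ?thesis
    using R_iff[of B D "M \<union> E"] assms
      reach_sym[OF graph_sym, of D "B \<union> D \<union> E \<union> M" "M \<union> E" B] by simp
qed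

text \<open>
  This is what makes \<open>H\<close> below the common graph of all separators that lie in the closure of
  \<open>B \<union> D \<union> E\<close>.
\<close>
lemma graph_absorb:
  assumes "S \<subseteq> V" "M \<subseteq> cl S"
  shows "graph (S \<union> M) = graph S"
proof (rule antisym)
  show "graph (S \<union> M) \<subseteq> graph S" using assms cl_extensive by (intro graph_mono) auto
  have "S \<union> M \<subseteq> V" using assms cl_sub by auto
  then have "S \<subseteq> cl (S \<union> M)" using cl_extensive by blast
  then show "graph S \<subseteq> graph (S \<union> M)" by (rule graph_mono)
qed

lemma reach_local:
  assumes "B \<inter> reach (graph (B \<union> D \<union> F)) F D = {}" "B \<union> D \<union> F \<subseteq> V"
  shows "reach (graph (B \<union> D \<union> F)) F D = reach (graph (D \<union> F)) F D"
proof
  show "reach (graph (D \<union> F)) F D \<subseteq> reach (graph (B \<union> D \<union> F)) F D"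
    using cl_extensive[OF assms(2)] by (intro reach_mono graph_mono) auto
  show "reach (graph (B \<union> D \<union> F)) F D \<subseteq> reach (graph (D \<union> F)) F D"
  proof
    fix y assume "y \<in> reach (graph (B \<union> D \<union> F)) F D"
    then show "y \<in> reach (graph (D \<union> F)) F D"
    proof (induction rule: reach_induct)
      case (start x)
      then show ?case by (rule reach_start)
    next
      case (step u v)
      have "v \<in> reach (graph (B \<union> D \<union> F)) F D" using step by (auto intro: reach_step)
      then have "(u, v) \<in> graph (D \<union> F)" using local_edge[OF assms step(1)] step(2) by blast
      then show ?case using step by (auto intro: reach_step)
    qed
  qed
qed

end

section \<open>The directed Markov blanket under abstract separation\<close>

text \<open>
  A fixed instance of the problem. Below, \<open>blanket\<close> and \<open>dir_blanket\<close> turn out to be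
  \<open>mb\<^bsub>C\<^esub>(B|E)\<close> and \<open>mb(B \<rightarrow> D|E)\<close>.
\<close>
locale separable = local_separation V cl graph R
  for V :: "'v set" and cl graph R +
  fixes B D E :: "'v set"
  assumes sub: "B \<subseteq> V" "D \<subseteq> V" "E \<subseteq> V"
    and separable: "\<exists>M. separator R V B D E M"
begin

abbreviation C where "C \<equiv> cl (B \<union> D \<union> E)"
abbreviation H where "H \<equiv> graph (B \<union> D \<union> E)"

definition blanket where "blanket = {v \<in> C - B - E. \<exists>b\<in>B - E. (b, v) \<in> H}"

definition dir_blanket where "dir_blanket = {n \<in> blanket. \<exists>u\<in>reach H (blanket \<union> E) D. (u, n) \<in> H}"

lemma C_sub: "C \<subseteq> V" "B \<union> D \<union> E \<subseteq> C"
  using cl_sub[of "B \<union> D \<union> E"] cl_extensive[of "B \<union> D \<union> E"] sub by auto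

lemma separates_iff:
  assumes "K \<subseteq> C"
  shows "R B D (K \<union> E) \<longleftrightarrow> B \<inter> reach H (K \<union> E) D = {}"
  using separator_iff[of B D E K] graph_absorb[of "B \<union> D \<union> E" K] assms sub C_sub by auto

lemma B_Int_D: "B \<inter> D \<subseteq> E"
proof
  fix x assume x: "x \<in> B \<inter> D"
  obtain K where K: "separator R V B D E K" using separable by auto
  show "x \<in> E"
    using K separator_iff[of B D E K] sub x reach_start[of x D "K \<union> E"]
    unfolding separator_def by fastforce
qed

lemma separator_reach:
  assumes "separator R V B D E K"
  shows "B \<inter> reach (graph (B \<union> D \<union> E \<union> K)) (K \<union> E) D = {}" "K \<subseteq> V" "K \<inter> (B \<union> D) = {}"
    "H \<subseteq> graph (B \<union> D \<union> E \<union> K)"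
proof -
  show K: "K \<subseteq> V" "K \<inter> (B \<union> D) = {}" using assms unfolding separator_def by auto
  then show "B \<inter> reach (graph (B \<union> D \<union> E \<union> K)) (K \<union> E) D = {}"
    using assms separator_iff[of B D E K] sub unfolding separator_def by auto
  show "H \<subseteq> graph (B \<union> D \<union> E \<union> K)"
    using K sub cl_extensive[of "B \<union> D \<union> E \<union> K"] by (intro graph_mono) auto
qed

text \<open>
  An edge of \<open>H\<close> between \<open>B - E\<close> and \<open>D - E\<close> would defeat every separator, since separators
  contain vertices of neither set.
\<close>
lemma blanket_Int_D: "blanket \<inter> D = {}"
proof (rule ccontr)
  assume "blanket \<inter> D \<noteq> {}"
  then obtain n b where n: "n \<in> D" "n \<notin> E" "b \<in> B" "b \<notin> E" "(b, n) \<in> H"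
    unfolding blanket_def by auto
  obtain K where "separator R V B D E K" using separable by auto
  note K = separator_reach[OF this]
  have "n \<in> reach (graph (B \<union> D \<union> E \<union> K)) (K \<union> E) D" using n K(3) by (auto intro: reach_start)
  moreover have "(n, b) \<in> graph (B \<union> D \<union> E \<union> K)" using n K(4) graph_sym by (meson subsetD symD)
  ultimately have "b \<in> reach (graph (B \<union> D \<union> E \<union> K)) (K \<union> E) D"
    using n K(3) by (auto intro: reach_step)
  then show False using K(1) n by auto
qed

text \<open>
  When everything in \<open>C\<close> outside \<open>B \<union> {v}\<close> is deleted, a walk from \<open>B\<close> to \<open>v\<close> stays in \<open>B - E\<close>
  until it steps to \<open>v\<close>.
\<close>
lemma mb_in_C_eq_blanket: "mb_in R C B E = blanket"
proof -
  have H: "graph (B \<union> C \<union> E) = H"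
  proof -
    have "B \<union> C \<union> E = (B \<union> D \<union> E) \<union> C" using C_sub by auto
    then show ?thesis using graph_absorb[of "B \<union> D \<union> E" C] sub by auto
  qed
  have "v \<in> reach H (E \<union> (C - (B \<union> {v}))) B \<longleftrightarrow> v \<notin> E \<and> (\<exists>b\<in>B - E. (b, v) \<in> H)"
    (is "_ \<in> ?r \<longleftrightarrow> _") if v: "v \<in> C - B" for v
  proof
    assume r: "v \<in> ?r"
    have "w \<in> B - E \<or> w = v \<and> (\<exists>b\<in>B - E. (b, v) \<in> H)" if "w \<in> ?r" for w
      using that
    proof (induction rule: reach_induct)
      case (start x)
      then show ?case by auto
    next
      case (step u w)
      then have "w \<in> C" using graph_sub by auto
      then show ?case using step by auto
    qed
    then show "v \<notin> E \<and> (\<exists>b\<in>B - E. (b, v) \<in> H)" using r v reach_avoids by fastforce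
  next
    assume "v \<notin> E \<and> (\<exists>b\<in>B - E. (b, v) \<in> H)"
    then obtain b where b: "v \<notin> E" "b \<in> B - E" "(b, v) \<in> H" by auto
    then have "b \<in> ?r" by (auto intro: reach_start)
    then show "v \<in> ?r" using b by (auto intro: reach_step)
  qed
  then show ?thesis
    using mb_in_reach[OF C_sub(1) sub(1,3)] H unfolding blanket_def by auto
qed

lemma blanket_separates: "B \<inter> reach H (blanket \<union> E) D = {}"
proof -
  have "y \<notin> B" if "y \<in> reach H (blanket \<union> E) D" for y
    using that
  proof (induction rule: reach_induct)
    case (start x)
    then show ?case using B_Int_D by auto
  next
    case (step u v)
    have "(v, u) \<in> H" using graph_sym step(2) by (rule symD)
    moreover from this have "u \<in> C" using graph_sub by blast
    ultimately show ?case using step reach_avoids[OF step(1)] unfolding blanket_def by auto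
  qed
  then show ?thesis by auto
qed

lemma blanket_sub: "blanket \<subseteq> C" "blanket \<inter> B = {}" "blanket \<inter> E = {}"
  unfolding blanket_def by auto

text \<open>
  The inner Markov blanket is computed in the graph of \<open>D \<union> N \<union> E\<close> with \<open>N\<close> the blanket of \<open>B\<close>,
  whereas \<open>dir_blanket\<close> refers to \<open>H\<close>. Since \<open>N\<close> cuts \<open>D\<close> off from \<open>B\<close>, both graphs agree on
  what is reached from \<open>D\<close> up to \<open>N\<close>.
\<close>
lemma mb_in_blanket_eq_dir_blanket: "mb_in R blanket D E = dir_blanket"
proof -
  let ?H = "graph (D \<union> (blanket \<union> E))"
  have eq: "graph (B \<union> D \<union> (blanket \<union> E)) = H"
  proof -
    have "B \<union> D \<union> (blanket \<union> E) = (B \<union> D \<union> E) \<union> blanket" by auto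
    then show ?thesis using graph_absorb[of "B \<union> D \<union> E" blanket] sub blanket_sub by auto
  qed
  have subV: "B \<union> D \<union> (blanket \<union> E) \<subseteq> V" using sub blanket_sub C_sub by auto
  have sep: "B \<inter> reach (graph (B \<union> D \<union> (blanket \<union> E))) (blanket \<union> E) D = {}"
    using blanket_separates eq by simp
  have r: "reach ?H (blanket \<union> E) D = reach H (blanket \<union> E) D"
    using reach_local[OF sep subV] eq by simp
  have sH: "?H \<subseteq> H"
    using C_sub blanket_sub by (intro graph_mono) auto
  have main: "n \<in> reach ?H (E \<union> (blanket - (D \<union> {n}))) D \<longleftrightarrow> (\<exists>u\<in>reach H (blanket \<union> E) D. (u, n) \<in> H)"
    if n: "n \<in> blanket" for n
  proof -
    have e: "E \<union> (blanket - (D \<union> {n})) = (blanket \<union> E) - {n}" using blanket_Int_D blanket_sub n by auto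
    show ?thesis
    proof
      assume "n \<in> reach ?H (E \<union> (blanket - (D \<union> {n}))) D"
      then have "n \<in> reach ?H ((blanket \<union> E) - {n}) D" using e by simp
      then show "\<exists>u\<in>reach H (blanket \<union> E) D. (u, n) \<in> H"
        using reach_last_step[of n ?H "blanket \<union> E" D] blanket_Int_D n r sH by blast
    next
      assume "\<exists>u\<in>reach H (blanket \<union> E) D. (u, n) \<in> H"
      then obtain u where u: "u \<in> reach H (blanket \<union> E) D" "(u, n) \<in> H" by auto
      then have "(u, n) \<in> ?H" using local_edge[OF sep subV, of u n] eq n by auto
      moreover have "u \<in> reach ?H ((blanket \<union> E) - {n}) D"
        using u(1) r reach_mono[of ?H ?H "(blanket \<union> E) - {n}" "blanket \<union> E" D] by auto
      ultimately show "n \<in> reach ?H (E \<union> (blanket - (D \<union> {n}))) D" using e by (auto intro: reach_step)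
    qed
  qed
  have "blanket \<subseteq> V" using blanket_sub C_sub by auto
  then show ?thesis
    using mb_in_reach[of blanket D E] sub main blanket_Int_D unfolding dir_blanket_def by (auto simp: Un_assoc)
qed

lemma blanket_neighbour:
  assumes "n \<in> blanket" obtains b where "b \<in> B" "b \<notin> E" "(n, b) \<in> H"
proof -
  obtain b where "b \<in> B - E" "(b, n) \<in> H" using assms unfolding blanket_def by auto
  then show thesis using that[of b] graph_sym by (auto dest: symD)
qed

text \<open>
  Minimality and the condition on other separators \<open>K\<close> rest on the same continuation: each
  \<open>m \<in> dir_blanket\<close> has a neighbour in \<open>B - E\<close>, and \<open>K\<close> does not contain it. So a walk from \<open>D\<close> to
  \<open>m\<close> that avoids \<open>K \<union> E\<close> leads on to \<open>B\<close>.
\<close>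
lemma is_mb_dir_dir_blanket: "is_mb_dir R V B D E dir_blanket"
proof -
  have MN: "dir_blanket \<subseteq> blanket" unfolding dir_blanket_def by auto
  have "reach H (dir_blanket \<union> E) D \<subseteq> reach H (blanket \<union> E) D"
  proof
    fix y assume "y \<in> reach H (dir_blanket \<union> E) D"
    then show "y \<in> reach H (blanket \<union> E) D"
    proof (induction rule: reach_induct)
      case (start x)
      then show ?case using blanket_Int_D by (auto intro: reach_start)
    next
      case (step u v)
      then have "v \<notin> blanket" unfolding dir_blanket_def by auto
      then show ?case using step by (auto intro: reach_step)
    qed
  qed
  then have "B \<inter> reach H (dir_blanket \<union> E) D = {}" using blanket_separates by auto
  then have "R B D (dir_blanket \<union> E)" using separates_iff[of dir_blanket] MN blanket_sub by auto
  then have sepM: "separator R V B D E dir_blanket"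
    using MN blanket_sub blanket_Int_D C_sub unfolding separator_def by auto
  have minM: "\<not> R B D (K \<union> E)" if K: "K \<subset> dir_blanket" for K
  proof
    assume r: "R B D (K \<union> E)"
    obtain n where n: "n \<in> dir_blanket" "n \<notin> K" using K by auto
    then obtain u where u: "u \<in> reach H (blanket \<union> E) D" "(u, n) \<in> H" unfolding dir_blanket_def by auto
    have nN: "n \<in> blanket" using n MN by auto
    then obtain b where b: "b \<in> B" "b \<notin> E" "(n, b) \<in> H" by (rule blanket_neighbour)
    have "u \<in> reach H (K \<union> E) D"
      using u(1) reach_mono[of H H "K \<union> E" "blanket \<union> E" D] K MN by blast
    then have "n \<in> reach H (K \<union> E) D" using u(2) n(2) nN blanket_sub by (auto intro: reach_step)
    moreover have "b \<notin> K \<union> E" using b K MN blanket_sub by blast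
    ultimately have "b \<in> reach H (K \<union> E) D" using b(3) reach_step by metis
    moreover have "K \<subseteq> C" using K MN blanket_sub by blast
    ultimately show False using r separates_iff b(1) by blast
  qed
  have "R D dir_blanket (K \<union> E)" if K: "separator R V B D E K" for K
  proof (rule ccontr)
    assume "\<not> R D dir_blanket (K \<union> E)"
    note s = separator_reach[OF K]
    let ?G = "graph (B \<union> D \<union> E \<union> K)"
    have MV: "dir_blanket \<subseteq> V" using MN blanket_sub C_sub by auto
    obtain m where m: "m \<in> dir_blanket" "m \<in> reach (graph (D \<union> dir_blanket \<union> (K \<union> E))) (K \<union> E) D"
      using \<open>\<not> R D dir_blanket (K \<union> E)\<close> R_iff[of D dir_blanket "K \<union> E"] sub s MV by auto
    have V: "B \<union> D \<union> E \<union> K \<subseteq> V" using sub s by auto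
    have "C \<subseteq> cl (B \<union> D \<union> E \<union> K)" using cl_extensive[OF V] by (intro cl_least) auto
    then have "graph (D \<union> dir_blanket \<union> (K \<union> E)) \<subseteq> ?G"
      using cl_extensive[OF V] MN blanket_sub by (intro graph_mono) auto
    then have "m \<in> reach ?G (K \<union> E) D" using m(2) reach_mono by blast
    moreover obtain b where b: "b \<in> B" "b \<notin> E" "(m, b) \<in> H"
      using blanket_neighbour m(1) MN by blast
    ultimately have "b \<in> reach ?G (K \<union> E) D" using s by (auto intro: reach_step)
    then show False using s b by auto
  qed
  then show ?thesis
    using sepM minM unfolding is_mb_dir_def minimal_separator_def by auto
qed

text \<open>
  The part of a separator inside \<open>C\<close> separates already: it is tested in \<open>H\<close>, a subgraph of the
  graph of the whole separator, and the vertices outside \<open>C\<close> delete nothing from \<open>H\<close>.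
\<close>
lemma minimal_separator_sub:
  assumes "minimal_separator R V B D E K"
  shows "K \<subseteq> C"
proof (rule ccontr)
  assume "\<not> K \<subseteq> C"
  then have less: "K \<inter> C \<subset> K" by auto
  have K: "separator R V B D E K" using assms unfolding minimal_separator_def by auto
  note s = separator_reach[OF K]
  have "reach H (K \<inter> C \<union> E) D \<subseteq> reach (graph (B \<union> D \<union> E \<union> K)) (K \<union> E) D"
  proof
    fix y assume "y \<in> reach H (K \<inter> C \<union> E) D"
    then show "y \<in> reach (graph (B \<union> D \<union> E \<union> K)) (K \<union> E) D"
    proof (induction rule: reach_induct)
      case (start x)
      then show ?case using s by (auto intro: reach_start)
    next
      case (step u v)
      have "v \<in> C" using step(2) graph_sub by auto
      then show ?case using step s by (auto intro: reach_step)
    qed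
  qed
  then have "R B D (K \<inter> C \<union> E)" using separates_iff[of "K \<inter> C"] s by auto
  then show False using assms less unfolding minimal_separator_def by auto
qed

text \<open>
  The intersection of two solutions separates \<open>B\<close> from \<open>D\<close>, because walks from \<open>D\<close> enter their union
  only through the intersection.
\<close>
lemma is_mb_dir_unique:
  assumes K: "is_mb_dir R V B D E K" and L: "is_mb_dir R V B D E L"
  shows "K = L"
proof -
  have min: "minimal_separator R V B D E K" "minimal_separator R V B D E L"
    using K L unfolding is_mb_dir_def by auto
  then have sep: "separator R V B D E K" "separator R V B D E L"
    unfolding minimal_separator_def by auto
  have C: "K \<subseteq> C" "L \<subseteq> C" using min minimal_separator_sub by auto
  have R: "R D K (L \<union> E)" "R D L (K \<union> E)" "R B D (K \<union> E)"
    using K L sep unfolding is_mb_dir_def separator_def by auto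
  let ?F = "K \<union> L \<union> E"
  have eq: "graph (B \<union> D \<union> ?F) = H"
  proof -
    have "B \<union> D \<union> ?F = (B \<union> D \<union> E) \<union> (K \<union> L)" by auto
    then show ?thesis using graph_absorb[of "B \<union> D \<union> E" "K \<union> L"] sub C by auto
  qed
  have V: "B \<union> D \<union> ?F \<subseteq> V" using sub C C_sub by auto
  have KE: "B \<inter> reach H (K \<union> E) D = {}" using R(3) separates_iff C by auto
  then have noB: "B \<inter> reach H ?F D = {}"
    using reach_mono[of H H "K \<union> E" ?F D] by auto
  then have s: "B \<inter> reach (graph (B \<union> D \<union> ?F)) ?F D = {}" using eq by simp
  have loc: "reach H ?F D = reach (graph (D \<union> ?F)) ?F D" using reach_local[OF s V] eq by simp
  \<comment> \<open>The entry points of walks from \<open>D\<close> into \<open>K \<union> L\<close> lie in both sets; to be used with \<open>(X, Y)\<close>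
    equal to \<open>(K, L)\<close> and to \<open>(L, K)\<close>. The statement \<open>D \<bottom> X | Y \<union> E\<close> is one about the graph of
    \<open>D \<union> K \<union> L \<union> E\<close>, hence the passage from \<open>H\<close> to \<open>?G\<close>.\<close>
  have boundary: "n \<in> Y"
    if XY: "R D X (Y \<union> E)" "X \<union> Y = K \<union> L" "X \<subseteq> V" "Y \<subseteq> V"
      and u: "u \<in> reach H ?F D" "(u, n) \<in> H" and n: "n \<in> X" "n \<notin> E" for X Y u n
  proof (rule ccontr)
    assume nY: "n \<notin> Y"
    let ?G = "graph (D \<union> ?F)"
    have "(u, n) \<in> ?G" using local_edge[OF s V, of u n] eq u n XY by auto
    moreover have "u \<in> reach ?G (Y \<union> E) D"
      using u(1) loc reach_mono[of ?G ?G "Y \<union> E" ?F D] XY by auto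
    ultimately have "n \<in> reach ?G (Y \<union> E) D" using n nY by (auto intro: reach_step)
    moreover have "D \<union> X \<union> (Y \<union> E) = D \<union> ?F" using XY by auto
    ultimately show False using R_iff[of D X "Y \<union> E"] XY sub n by auto
  qed
  have KLV: "K \<subseteq> V" "L \<subseteq> V" using C C_sub by auto
  have "reach H (K \<inter> L \<union> E) D \<subseteq> reach H ?F D"
  proof
    fix y assume "y \<in> reach H (K \<inter> L \<union> E) D"
    then show "y \<in> reach H ?F D"
    proof (induction rule: reach_induct)
      case (start x)
      then show ?case using sep unfolding separator_def by (auto intro: reach_start)
    next
      case (step u v)
      have "v \<notin> K" "v \<notin> L"
        using boundary[OF R(1) refl KLV step(5,2)] boundary[OF R(2) Un_commute KLV(2,1) step(5,2)]
          step(4) by blast+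
      then show ?case using step by (auto intro: reach_step)
    qed
  qed
  then have "B \<inter> reach H (K \<inter> L \<union> E) D = {}" using noB by auto
  then have "R B D (K \<inter> L \<union> E)" using separates_iff[of "K \<inter> L"] C by auto
  then have "\<not> K \<inter> L \<subset> K" "\<not> K \<inter> L \<subset> L"
    using min unfolding minimal_separator_def by auto
  then show ?thesis by auto
qed

lemma ex1_mb_dir_and_formula: "(\<exists>!K. is_mb_dir R V B D E K) \<and> mb_dir R V B D E = mb_in R (mb_in R C B E) D E"
proof -
  have ex1: "\<exists>!K. is_mb_dir R V B D E K"
  proof (rule ex1I)
    show "is_mb_dir R V B D E dir_blanket" by (rule is_mb_dir_dir_blanket)
    show "K = dir_blanket" if "is_mb_dir R V B D E K" for K
      using that is_mb_dir_dir_blanket by (rule is_mb_dir_unique)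
  qed
  then have "mb_dir R V B D E = dir_blanket"
    unfolding mb_dir_def using is_mb_dir_dir_blanket by (rule the1_equality)
  then show ?thesis using ex1 by (simp add: mb_in_C_eq_blanket mb_in_blanket_eq_dir_blanket)
qed

end

section \<open>Paths in undirected graphs\<close>

lemma path_imp_reach:
  assumes "is_path V A p" "path_active Z p" "hd p \<in> X"
  shows "last p \<in> reach A Z X"
  using assms
proof (induction p rule: rev_induct)
  case Nil
  then show ?case by (simp add: is_path_def)
next
  case (snoc v q)
  show ?case
  proof (cases "q = []")
    case True
    then show ?thesis using snoc.prems by (auto simp: path_active_def intro: reach_start)
  next
    case False
    then have "last q \<in> reach A Z X" "(last q, v) \<in> A" "v \<notin> Z"
      using snoc by (auto simp: is_path_def path_active_def successively_append_iff)
    then show ?thesis by (auto intro: reach_step)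
  qed
qed

lemma reach_imp_path:
  assumes "A \<subseteq> V \<times> V" "X \<subseteq> V" "y \<in> reach A Z X"
  shows "\<exists>p. is_path V A p \<and> path_active Z p \<and> hd p \<in> X \<and> last p = y"
  using assms(3)
proof (induction rule: reach_induct)
  case (start x)
  then show ?case using assms(2)
    by (intro exI[of _ "[x]"]) (auto simp: is_path_def path_active_def)
next
  case (step u v)
  then obtain p where "is_path V A p" "path_active Z p" "hd p \<in> X" "last p = u" by auto
  then show ?case using step assms(1)
    by (intro exI[of _ "p @ [v]"])
      (auto simp: is_path_def path_active_def successively_append_iff)
qed

lemma sep_iff_reach:
  assumes "A \<subseteq> V \<times> V" "X \<subseteq> V"
  shows "sep V A X Y Z \<longleftrightarrow> Y \<inter> reach A Z X = {}"
  unfolding sep_def using path_imp_reach[of V A] reach_imp_path[OF assms] by blast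

lemma local_separation_undirected:
  assumes "undirected_graph V A"
  shows "local_separation V (\<lambda>_. V) (\<lambda>_. A) (sep V A)"
  using assms sep_iff_reach[of A V] by unfold_locales (simp_all add: undirected_graph_def)

section \<open>Active trails in directed acyclic graphs\<close>

text \<open>
  The vertices \<open>v\<close> to which some trail from \<open>X\<close> leads all of whose vertices other than \<open>v\<close> satisfy
  the activity condition. The Boolean records whether the last edge points into \<open>v\<close>, since this
  and the next edge decide whether \<open>v\<close> is a v-structure once the trail is prolonged.
\<close>
inductive open_at :: "'v rel \<Rightarrow> 'v set \<Rightarrow> 'v set \<Rightarrow> 'v \<Rightarrow> bool \<Rightarrow> bool" for A X Z where
  start: "x \<in> X \<Longrightarrow> open_at A X Z x False"
| step: "\<lbrakk>open_at A X Z u into; (u, v) \<in> A \<or> (v, u) \<in> A;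
    if into \<and> (v, u) \<in> A then dsc A u \<inter> Z \<noteq> {} else u \<notin> Z\<rbrakk>
    \<Longrightarrow> open_at A X Z v ((u, v) \<in> A)"

definition enters_last :: "'v rel \<Rightarrow> 'v list \<Rightarrow> bool" where
  "enters_last A p \<longleftrightarrow> 1 < length p \<and> (p ! (length p - 2), last p) \<in> A"

definition active_before_last :: "'v rel \<Rightarrow> 'v set \<Rightarrow> 'v list \<Rightarrow> bool" where
  "active_before_last A Z p \<longleftrightarrow>
     (\<forall>i. Suc i < length p \<longrightarrow>
       (if v_structure A p i then dsc A (p ! i) \<inter> Z \<noteq> {} else p ! i \<notin> Z))"

lemma trail_active_iff:
  assumes "p \<noteq> []"
  shows "trail_active A Z p \<longleftrightarrow> active_before_last A Z p \<and> last p \<notin> Z"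
proof -
  have l: "\<not> v_structure A p (length p - 1)" "p ! (length p - 1) = last p"
    using assms by (auto simp: v_structure_def last_conv_nth)
  have "i < length p \<longleftrightarrow> Suc i < length p \<or> i = length p - 1" for i using assms
    by (cases p) auto
  then have "(\<forall>i<length p. P i) \<longleftrightarrow> (\<forall>i. Suc i < length p \<longrightarrow> P i) \<and> P (length p - 1)" for P
    by metis
  then show ?thesis unfolding trail_active_def active_before_last_def by (simp only: l if_False)
qed

lemma enters_last_snoc: "q \<noteq> [] \<Longrightarrow> enters_last A (q @ [v]) \<longleftrightarrow> (last q, v) \<in> A"
  by (cases q rule: rev_cases) (auto simp: enters_last_def nth_append)

lemma active_before_last_snoc:
  assumes "q \<noteq> []"
  shows "active_before_last A Z (q @ [v]) \<longleftrightarrow> active_before_last A Z q \<and>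
    (if enters_last A q \<and> (v, last q) \<in> A then dsc A (last q) \<inter> Z \<noteq> {} else last q \<notin> Z)"
proof -
  have old: "v_structure A (q @ [v]) i \<longleftrightarrow> v_structure A q i" if "Suc i < length q" for i
    using that by (auto simp: v_structure_def nth_append)
  have new: "v_structure A (q @ [v]) (length q - 1) \<longleftrightarrow> enters_last A q \<and> (v, last q) \<in> A"
    using assms by (auto simp: v_structure_def nth_append enters_last_def last_conv_nth numeral_2_eq_2)
  have entries: "(q @ [v]) ! i = q ! i" if "Suc i < length q" for i
    using that by (simp add: nth_append)
  have last: "(q @ [v]) ! (length q - 1) = last q"
    using assms by (simp add: nth_append last_conv_nth)
  have "Suc i < length (q @ [v]) \<longleftrightarrow> Suc i < length q \<or> i = length q - 1" for i
    using assms by (cases q) auto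
  then have "(\<forall>i. Suc i < length (q @ [v]) \<longrightarrow> P i) \<longleftrightarrow>
    (\<forall>i. Suc i < length q \<longrightarrow> P i) \<and> P (length q - 1)" for P by metis
  then show ?thesis
    unfolding active_before_last_def by (simp only: last new) (simp add: old entries)
qed

lemma trail_imp_open_at:
  assumes "is_trail V A p" "active_before_last A Z p" "hd p \<in> X"
  shows "open_at A X Z (last p) (enters_last A p)"
  using assms
proof (induction p rule: rev_induct)
  case Nil
  then show ?case by (simp add: is_trail_def)
next
  case (snoc v q)
  show ?case
  proof (cases "q = []")
    case True
    then show ?thesis using snoc.prems by (auto simp: enters_last_def intro: open_at.start)
  next
    case False
    then have "is_trail V A q" "(last q, v) \<in> A \<or> (v, last q) \<in> A" "hd q \<in> X"
      using snoc.prems by (auto simp: is_trail_def successively_append_iff)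
    then show ?thesis
      using open_at.step[of A X Z "last q" "enters_last A q" v] snoc.IH
        snoc.prems(2)[unfolded active_before_last_snoc[OF False]] enters_last_snoc[OF False]
      by simp
  qed
qed

lemma open_at_imp_trail:
  assumes "A \<subseteq> V \<times> V" "X \<subseteq> V" "open_at A X Z v into"
  shows "\<exists>p. is_trail V A p \<and> active_before_last A Z p \<and> hd p \<in> X \<and> last p = v \<and>
    enters_last A p = into"
  using assms(3)
proof (induction rule: open_at.induct)
  case (start x)
  then show ?case using assms(2)
    by (intro exI[of _ "[x]"]) (auto simp: is_trail_def active_before_last_def enters_last_def)
next
  case (step u into v)
  then obtain p where p: "is_trail V A p" "active_before_last A Z p" "hd p \<in> X" "last p = u"
    "enters_last A p = into" by auto
  then have "p \<noteq> []" by (auto simp: is_trail_def)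
  then show ?case using p step assms(1)
    by (intro exI[of _ "p @ [v]"])
      (auto simp: is_trail_def active_before_last_snoc enters_last_snoc successively_append_iff)
qed

text \<open>
  The last vertex of a trail is no v-structure, so that a trail that is active up to its last vertex
  is active iff that vertex is outside \<open>Z\<close>.
\<close>
lemma dsep_iff_open_at:
  assumes "A \<subseteq> V \<times> V" "X \<subseteq> V"
  shows "dsep V A X Y Z \<longleftrightarrow> \<not> (\<exists>y\<in>Y - Z. \<exists>into. open_at A X Z y into)"
proof -
  have "(\<exists>p. is_trail V A p \<and> trail_active A Z p \<and> hd p \<in> X \<and> last p \<in> Y) \<longleftrightarrow>
      (\<exists>y\<in>Y - Z. \<exists>into. open_at A X Z y into)" (is "?l \<longleftrightarrow> ?r")
  proof
    assume ?l
    then obtain p where p: "is_trail V A p" "trail_active A Z p" "hd p \<in> X" "last p \<in> Y" by auto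
    then have "p \<noteq> []" by (auto simp: is_trail_def)
    then show ?r using trail_imp_open_at[OF p(1) _ p(3)] p trail_active_iff by blast
  next
    assume ?r
    then obtain y into where y: "y \<in> Y - Z" "open_at A X Z y into" by auto
    obtain p where p: "is_trail V A p" "active_before_last A Z p" "hd p \<in> X" "last p = y"
      using open_at_imp_trail[OF assms y(2)] by auto
    then have "p \<noteq> []" by (auto simp: is_trail_def)
    then show ?l using p y trail_active_iff by blast
  qed
  then show ?thesis unfolding dsep_def by simp
qed

section \<open>The moral graph criterion\<close>

text \<open>
  The moral graph of the subgraph induced by \<open>S\<close>. The loops at parents that
  its last clause contains for \<open>u = v\<close> match trails that go to a child and straight back.
\<close>
definition moral :: "'v rel \<Rightarrow> 'v set \<Rightarrow> 'v rel" where
  "moral A S = {(u, v). u \<in> S \<and> v \<in> S \<and>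
     ((u, v) \<in> A \<or> (v, u) \<in> A \<or> (\<exists>w\<in>S. (u, w) \<in> A \<and> (v, w) \<in> A))}"

lemma moral_mono: "S \<subseteq> T \<Longrightarrow> moral A S \<subseteq> moral A T"
  unfolding moral_def by blast

lemma asc_extensive: "S \<subseteq> asc A S"
  unfolding asc_def by auto

lemma asc_self: "v \<in> S \<Longrightarrow> v \<in> asc A S"
  using asc_extensive by fast

lemma asc_least: "S \<subseteq> asc A T \<Longrightarrow> asc A S \<subseteq> asc A T"
  unfolding asc_def by (blast intro: rtrancl_trans)

lemma asc_mono: "S \<subseteq> T \<Longrightarrow> asc A S \<subseteq> asc A T"
  unfolding asc_def by auto

lemma asc_parent: "(u, v) \<in> A \<Longrightarrow> v \<in> asc A S \<Longrightarrow> u \<in> asc A S"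
  unfolding asc_def by (auto intro: converse_rtrancl_into_rtrancl)

lemma dsc_meets_iff: "dsc A u \<inter> Z \<noteq> {} \<longleftrightarrow> u \<in> asc A Z"
  unfolding dsc_def asc_def by auto

lemma acyclic_asym: "acyclic A \<Longrightarrow> (u, v) \<in> A \<Longrightarrow> (v, u) \<notin> A"
  unfolding acyclic_def by (meson r_into_trancl trancl_trans)

text \<open>
  From active trails to moral walks: v-structures are skipped by the edge between their parents.
  As long as the trail runs against the arrows, its vertices are ancestors of its starting point or
  of a v-structure, hence of \<open>X \<union> Z\<close>. After a forward edge into \<open>u\<close> only ancestry of \<open>u\<close> itself can be
  guaranteed, and as \<open>u\<close> may become a v-structure in \<open>Z\<close>, the walk is only claimed to reach its parent.
\<close>
lemma open_at_imp_reach_moral: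
  assumes "acyclic A" "open_at A X Z u into"
  shows "if into then \<exists>w. (w, u) \<in> A \<and> w \<in> reach (moral A (asc A (insert u (X \<union> Z)))) Z X
    else u \<in> asc A (X \<union> Z) \<and> (u \<notin> Z \<longrightarrow> u \<in> reach (moral A (asc A (X \<union> Z))) Z X)"
  using assms(2)
proof (induction rule: open_at.induct)
  case (start x)
  then show ?case using asc_extensive[of "X \<union> Z" A] by (auto intro: reach_start)
next
  case (step u into v)
  let ?S = "\<lambda>u. asc A (insert u (X \<union> Z))" and ?T = "asc A (X \<union> Z)"
  have in_S: "u \<in> ?S u" "v \<in> ?S v" by (simp_all add: asc_self)
  show ?case
  proof (cases "(u, v) \<in> A")
    case True
    then have u: "u \<notin> Z" using step(3) acyclic_asym[OF assms(1)] by auto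
    have "u \<in> ?S v" using True in_S(2) by (rule asc_parent)
    then have sub: "?S u \<subseteq> ?S v" using asc_extensive[of "insert v (X \<union> Z)" A]
      by (intro asc_least) auto
    have "u \<in> reach (moral A (?S v)) Z X"
    proof (cases into)
      case True
      then obtain w where w: "(w, u) \<in> A" "w \<in> reach (moral A (?S u)) Z X" using step by auto
      have "w \<in> reach (moral A (?S v)) Z X" using w(2) reach_mono[OF moral_mono[OF sub]] by blast
      moreover have "w \<in> ?S u" using w(1) in_S(1) by (rule asc_parent)
      then have "(w, u) \<in> moral A (?S v)" using w(1) sub in_S unfolding moral_def by auto
      ultimately show ?thesis using u by (rule reach_step)
    next
      case False
      have "?T \<subseteq> ?S v" by (rule asc_mono) auto
      then show ?thesis using False step(4) u reach_mono[OF moral_mono] by fastforce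
    qed
    then show ?thesis using True by auto
  next
    case False
    then have vu: "(v, u) \<in> A" using step by auto
    show ?thesis
    proof (cases into)
      case True
      then have "u \<in> asc A Z" using step(3) vu dsc_meets_iff by metis
      then have u: "u \<in> ?T" using asc_mono[of Z "X \<union> Z"] by auto
      then have sub: "?S u \<subseteq> ?T" using asc_extensive[of "X \<union> Z" A] by (intro asc_least) auto
      obtain w where w: "(w, u) \<in> A" "w \<in> reach (moral A (?S u)) Z X" using step True by auto
      have "w \<in> reach (moral A ?T) Z X" using w(2) reach_mono[OF moral_mono[OF sub]] by blast
      moreover have "v \<in> ?T" "w \<in> ?T" using vu w(1) u by (auto intro: asc_parent)
      moreover from this have "(w, v) \<in> moral A ?T" using w(1) vu u unfolding moral_def by auto
      ultimately show ?thesis using False by (auto intro: reach_step)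
    next
      case notinto: False
      then have "u \<notin> Z" "u \<in> ?T" "u \<in> reach (moral A ?T) Z X" using step by auto
      moreover have "v \<in> ?T" using vu \<open>u \<in> ?T\<close> by (rule asc_parent)
      moreover have "(u, v) \<in> moral A ?T" using vu calculation unfolding moral_def by auto
      ultimately show ?thesis using False by (auto intro: reach_step)
    qed
  qed
qed

text \<open>
  The converse direction of the moral graph criterion has one difficulty. A moral walk may
  force a v-structure at a vertex \<open>u\<close> that is no ancestor of \<open>Z\<close>. Then \<open>u\<close> is an ancestor of \<open>X\<close> or
  \<open>Y\<close>, and the directed path from \<open>u\<close> to that set avoids \<open>Z\<close>. If it ends in \<open>Y\<close>, it completes an
  active trail; if it ends in \<open>X\<close>, its reverse is a new initial part, arriving at \<open>u\<close> against
  the arrow, for which \<open>u\<close> is no v-structure. The next lemmas provide these moves.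
\<close>
lemma open_at_forward:
  assumes "acyclic A" "open_at A X Z u into" "u \<notin> Z" "(u, v) \<in> A"
  shows "open_at A X Z v True"
  using open_at.step[OF assms(2), of v] acyclic_asym[OF assms(1,4)] assms(3,4) by simp

lemma open_at_descend:
  assumes "acyclic A" "open_at A X Z u into" "u \<notin> asc A Z" "(u, y) \<in> A\<^sup>*"
  shows "\<exists>into. open_at A X Z y into"
proof -
  have "y \<notin> Z \<and> (\<exists>into. open_at A X Z y into)"
    using assms(4)
  proof (induction rule: rtrancl_induct)
    case base
    then show ?case using assms(2,3) asc_self by metis
  next
    case (step v w)
    then have "w \<notin> Z" using assms(3) unfolding asc_def by (auto intro: rtrancl_into_rtrancl)
    then show ?case using step open_at_forward[OF assms(1)] by blast
  qed
  then show ?thesis ..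
qed

lemma open_at_ascend:
  assumes "acyclic A" "x \<in> X" "(u, x) \<in> A\<^sup>*" "u \<notin> asc A Z"
  shows "open_at A X Z u False"
  using assms(3,4)
proof (induction rule: converse_rtrancl_induct)
  case base
  then show ?case using assms(2) by (intro open_at.start)
next
  case (step u w)
  then have w: "w \<notin> asc A Z" by (auto dest: asc_parent)
  have "w \<notin> Z" using w asc_self by metis
  then show ?case
    using open_at.step[of A X Z w False u] step w acyclic_asym[OF assms(1) step(1)] by simp
qed

lemma open_at_backward:
  assumes "acyclic A" "open_at A X Z u into" "u \<notin> Z" "(v, u) \<in> A" "u \<in> asc A (X \<union> Y \<union> Z)"
  shows "(\<exists>into. open_at A X Z v into) \<or> (\<exists>y\<in>Y - Z. \<exists>into. open_at A X Z y into)"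
proof (cases "u \<in> asc A Z")
  case True
  then have "if into \<and> (v, u) \<in> A then dsc A u \<inter> Z \<noteq> {} else u \<notin> Z"
    using assms(3) dsc_meets_iff by metis
  then show ?thesis using open_at.step[OF assms(2)] assms(4) by blast
next
  case False
  then obtain t where t: "t \<in> X \<union> Y" "(u, t) \<in> A\<^sup>*" "t \<notin> Z"
    using assms(5) unfolding asc_def by auto
  show ?thesis
  proof (cases "t \<in> Y")
    case True
    then show ?thesis using open_at_descend[OF assms(1,2) False t(2)] t by auto
  next
    case notY: False
    then have "open_at A X Z u False" using open_at_ascend[OF assms(1) _ t(2) False] t by auto
    then show ?thesis using open_at.step[of A X Z u False v] assms(3,4) by auto
  qed
qed

lemma reach_moral_imp_open_at:
  assumes "acyclic A" "v \<in> reach (moral A (asc A (X \<union> Y \<union> Z))) Z X"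
  shows "(\<exists>into. open_at A X Z v into) \<or> (\<exists>y\<in>Y - Z. \<exists>into. open_at A X Z y into)"
    (is "?P v \<or> ?goal")
  using assms(2)
proof (induction rule: reach_induct)
  case (start x)
  then show ?case by (auto intro: open_at.start)
next
  case (step u v)
  show ?case
  proof (cases ?goal)
    case False
    then obtain into where u: "open_at A X Z u into" using step by auto
    note fwd = open_at_forward[OF assms(1) u \<open>u \<notin> Z\<close>]
    consider "(u, v) \<in> A" | "(v, u) \<in> A" "u \<in> asc A (X \<union> Y \<union> Z)"
      | w where "w \<in> asc A (X \<union> Y \<union> Z)" "(u, w) \<in> A" "(v, w) \<in> A"
      using step(2) unfolding moral_def by auto
    then show ?thesis
    proof cases
      case 1
      then show ?thesis using fwd by blast
    next
      case 2
      then show ?thesis using open_at_backward[OF assms(1) u \<open>u \<notin> Z\<close>] by blast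
    next
      \<comment> \<open>If the common child \<open>w\<close> is in \<open>Z\<close>, it is an open v-structure; otherwise the moral edge is
        a forward step followed by a backward step through \<open>w\<close>.\<close>
      case 3
      show ?thesis
      proof (cases "w \<in> Z")
        case True
        then have "dsc A w \<inter> Z \<noteq> {}" unfolding dsc_def by auto
        then show ?thesis using open_at.step[OF fwd[OF 3(2)], of v] 3(3) by auto
      next
        case False
        then show ?thesis using open_at_backward[OF assms(1) fwd[OF 3(2)] _ 3(3,1)] by blast
      qed
    qed
  qed simp
qed

lemma dsep_iff_reach_moral:
  assumes "acyclic_digraph V A" "X \<subseteq> V"
  shows "dsep V A X Y Z \<longleftrightarrow> Y \<inter> reach (moral A (asc A (X \<union> Y \<union> Z))) Z X = {}"
proof -
  let ?S = "asc A (X \<union> Y \<union> Z)"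
  have A: "A \<subseteq> V \<times> V" "acyclic A" using assms(1) unfolding acyclic_digraph_def by auto
  have "y \<in> reach (moral A ?S) Z X" if y: "y \<in> Y - Z" "open_at A X Z y into" for y into
  proof (cases into)
    case True
    then obtain w where w: "(w, y) \<in> A" "w \<in> reach (moral A (asc A (insert y (X \<union> Z)))) Z X"
      using open_at_imp_reach_moral[OF A(2) y(2)] by auto
    have "asc A (insert y (X \<union> Z)) \<subseteq> ?S" using y by (intro asc_mono) auto
    then have r: "w \<in> reach (moral A ?S) Z X" using w(2) reach_mono[OF moral_mono] by blast
    have "y \<in> ?S" using y asc_extensive[of "X \<union> Y \<union> Z" A] by auto
    moreover from this have "w \<in> ?S" using w(1) by (auto intro: asc_parent)
    ultimately have "(w, y) \<in> moral A ?S" using w(1) unfolding moral_def by auto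
    then show ?thesis using r y by (auto intro: reach_step)
  next
    case False
    have "asc A (X \<union> Z) \<subseteq> ?S" by (intro asc_mono) auto
    moreover have "y \<in> reach (moral A (asc A (X \<union> Z))) Z X"
      using open_at_imp_reach_moral[OF A(2) y(2)] False y by auto
    ultimately show ?thesis using reach_mono[OF moral_mono] by blast
  qed
  moreover have "\<exists>y\<in>Y - Z. \<exists>into. open_at A X Z y into"
    if "y \<in> Y" "y \<in> reach (moral A ?S) Z X" for y
    using reach_moral_imp_open_at[OF A(2) that(2)] that reach_avoids by fastforce
  ultimately show ?thesis
    unfolding dsep_iff_open_at[OF A(1) assms(2)] by blast
qed

section \<open>Locality of moral graphs\<close>

text \<open>
  Let a vertex \<open>w\<close> reached from \<open>D\<close>, or a common child that creates a moral edge, be no ancestor of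
  \<open>D \<union> F\<close>. Then it is an ancestor of \<open>B\<close>, and the directed path from it to \<open>B\<close> avoids \<open>F\<close>, because
  otherwise \<open>w\<close> would be an ancestor of \<open>F\<close>. So \<open>B\<close> would be reached from \<open>D\<close>.
\<close>
lemma moral_edge_local:
  fixes A :: "'v rel" and B D F :: "'v set"
  defines "G \<equiv> moral A (asc A (B \<union> D \<union> F))"
  assumes sep: "B \<inter> reach G F D = {}"
    and u: "u \<in> reach G F D" and v: "v \<in> F \<union> reach G F D" and edge: "(u, v) \<in> G"
  shows "(u, v) \<in> moral A (asc A (D \<union> F))"
proof -
  let ?S = "asc A (B \<union> D \<union> F)" and ?T = "asc A (D \<union> F)"
  have descend: "b \<in> reach G F D" if "(w, b) \<in> A\<^sup>*" "b \<in> B" "w \<in> reach G F D" "w \<notin> asc A F" for w b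
    using that
  proof (induction rule: converse_rtrancl_induct)
    case base
    then show ?case by simp
  next
    case (step w x)
    then have x: "x \<notin> asc A F" by (auto dest: asc_parent)
    have "x \<in> ?S" using step(2,4) unfolding asc_def by auto
    moreover from this have "w \<in> ?S" using step(1) by (auto intro: asc_parent)
    ultimately have "(w, x) \<in> G" using step(1) unfolding G_def moral_def by auto
    moreover have "x \<notin> F" using x asc_self by metis
    ultimately have "x \<in> reach G F D" using step by (auto intro: reach_step)
    then show ?case using step x by auto
  qed
  have reached: "w \<in> ?T" if r: "w \<in> reach G F D" "w \<in> ?S" for w
  proof (rule ccontr)
    assume w: "w \<notin> ?T"
    then obtain b where b: "b \<in> B" "(w, b) \<in> A\<^sup>*" using r(2) unfolding asc_def by auto
    have "w \<notin> asc A F" using w asc_mono[of F "D \<union> F"] by auto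
    then show False using descend[OF b(2,1) r(1)] sep b by auto
  qed
  have S: "u \<in> ?S" "v \<in> ?S" using edge unfolding G_def moral_def by auto
  have uT: "u \<in> ?T" using reached u S by auto
  have vT: "v \<in> ?T" using reached v S asc_extensive[of "D \<union> F" A] by auto
  have child: "w \<in> ?T" if w: "w \<in> ?S" "(u, w) \<in> A" for w
  proof (cases "w \<in> F")
    case True
    then show ?thesis using asc_extensive[of "D \<union> F" A] by auto
  next
    case False
    have "(u, w) \<in> G" using w S unfolding G_def moral_def by auto
    then show ?thesis using reached w False u by (auto intro: reach_step)
  qed
  show ?thesis using edge uT vT child unfolding G_def moral_def by auto
qed

lemma local_separation_directed:
  assumes "acyclic_digraph V A"
  shows "local_separation V (asc A) (\<lambda>S. moral A (asc A S)) (dsep V A)"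
proof
  have A: "A \<subseteq> V \<times> V" using assms unfolding acyclic_digraph_def by auto
  show "asc A S \<subseteq> V" if "S \<subseteq> V" for S
  proof
    fix u assume "u \<in> asc A S"
    then obtain s where s: "s \<in> S" "(u, s) \<in> A\<^sup>*" unfolding asc_def by auto
    from s(2) show "u \<in> V" by (cases rule: converse_rtranclE) (use s that A in auto)
  qed
  show "sym (moral A (asc A S))" for S unfolding sym_def moral_def by auto
  show "moral A (asc A S) \<subseteq> asc A S \<times> asc A S" for S unfolding moral_def by auto
  show "S \<subseteq> asc A S" for S by (rule asc_extensive)
  show "asc A S \<subseteq> asc A T" if "S \<subseteq> asc A T" for S T using that by (rule asc_least)
  show "moral A (asc A S) \<subseteq> moral A (asc A T)" if "S \<subseteq> asc A T" for S T
    using asc_least[OF that] by (rule moral_mono)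
  show "dsep V A X Y Z \<longleftrightarrow> Y \<inter> reach (moral A (asc A (X \<union> Y \<union> Z))) Z X = {}"
    if "X \<subseteq> V" for X Y Z
    by (rule dsep_iff_reach_moral[OF assms that])
qed (rule moral_edge_local)

section \<open>Existence, uniqueness and formula for the Markov blanket in a direction\<close>

theorem theorem4:
  fixes V :: "'v set" and A :: "'v rel" and B D E :: "'v set"
  assumes "B \<subseteq> V" and "D \<subseteq> V" and "E \<subseteq> V"
  shows
    "(undirected_graph V A \<and> (\<exists>M. separator (sep V A) V B D E M) \<longrightarrow>
        (\<exists>!M. is_mb_dir (sep V A) V B D E M) \<and>
        mb_dir (sep V A) V B D E =
          mb_in (sep V A) (mb_in (sep V A) V B E) D E)
     \<and>
     (acyclic_digraph V A \<and> (\<exists>M. separator (dsep V A) V B D E M) \<longrightarrow>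
        (\<exists>!M. is_mb_dir (dsep V A) V B D E M) \<and>
        mb_dir (dsep V A) V B D E =
          mb_in (dsep V A) (mb_in (dsep V A) (asc A (B \<union> D \<union> E)) B E) D E)"
proof (intro conjI impI; elim conjE)
  assume G: "undirected_graph V A" and s: "\<exists>M. separator (sep V A) V B D E M"
  interpret local_separation V "\<lambda>_. V" "\<lambda>_. A" "sep V A"
    by (rule local_separation_undirected[OF G])
  interpret separable V "\<lambda>_. V" "\<lambda>_. A" "sep V A" B D E
    using assms s by unfold_locales
  show "\<exists>!M. is_mb_dir (sep V A) V B D E M"
    and "mb_dir (sep V A) V B D E = mb_in (sep V A) (mb_in (sep V A) V B E) D E"
    using ex1_mb_dir_and_formula by blast+
next
  assume G: "acyclic_digraph V A" and s: "\<exists>M. separator (dsep V A) V B D E M"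
  interpret local_separation V "asc A" "\<lambda>S. moral A (asc A S)" "dsep V A"
    by (rule local_separation_directed[OF G])
  interpret separable V "asc A" "\<lambda>S. moral A (asc A S)" "dsep V A" B D E
    using assms s by unfold_locales
  show "\<exists>!M. is_mb_dir (dsep V A) V B D E M"
    and "mb_dir (dsep V A) V B D E =
      mb_in (dsep V A) (mb_in (dsep V A) (asc A (B \<union> D \<union> E)) B E) D E"
    using ex1_mb_dir_and_formula by blast+
qed

end
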